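(* Let $M,n,d\in\mathbb{N}$ and let ${\bm{x}}_i^m\in\mathbb{R}^d$ ($m\in[M]$, $i\in[n]$) satisfy $\|{\bm{x}}_i^m\|\le 1$, and assume the data are linearly separable, i.e. there is ${\bm{w}}$ with $\langle {\bm{w}},{\bm{x}}_i^m\rangle>0$ for all $m,i$. Let $\gamma=\max_{\|{\bm{w}}\|=1}\min_{m,i}\langle {\bm{w}},{\bm{x}}_i^m\rangle>0$. Let $\ell(z)=\log(1+e^{-z})$, $F_m({\bm{w}})=\frac1n\sum_{i=1}^n\ell(\langle {\bm{w}},{\bm{x}}_i^m\rangle)$, $F=\frac1M\sum_{m=1}^M F_m$. Run Local GD with arbitrary ${\bm{w}}_0\in\mathbb{R}^d$, any $\eta>0$ and any $K\in\mathbb{N}$: ${\bm{w}}_{r,0}^m={\bm{w}}_r$, ${\bm{w}}_{r,k+1}^m={\bm{w}}_{r,k}^m-\eta\nabla F_m({\bm{w}}_{r,k}^m)$ for $k=0,\dots,K-1$, and ${\bm{w}}_{r+1}=\frac1M\sum_{m=1}^M{\bm{w}}_{r,K}^m$. Define $\psi=\min\left(\frac{\gamma}{140\eta KM},\frac{1}{2Mn}\right)$ and $$\tau=\frac{4\gamma\|{\bm{w}}_0\|+2\sqrt2+2\eta+\log\left(1+\frac{\sqrt K}{\sqrt\eta\,\gamma\psi}\right)}{\eta\gamma^2\psi}.$$ Then for every $r\ge\tau$, $$F({\bm{w}}_r)\le\frac{16}{\eta\gamma^2K(r-\tau)}.$$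
   Context: Distributed logistic regression with labels absorbed into the data (each data point ${\bm{x}}_i^m$ has label $+1$). $\|\cdot\|$ is the Euclidean norm. *)

theory Defs
  imports "HOL-Analysis.Analysis"
begin

definition grad :: "('a::euclidean_space \<Rightarrow> real) \<Rightarrow> 'a \<Rightarrow> 'a" where
  "grad f w = (THE g. (f has_derivative (\<lambda>h. g \<bullet> h)) (at w))"

definition logloss :: "real \<Rightarrow> real" where
  "logloss z = ln (1 + exp (- z))"

definition Floc :: "(nat \<Rightarrow> nat \<Rightarrow> 'a::euclidean_space) \<Rightarrow> nat \<Rightarrow> nat \<Rightarrow> 'a \<Rightarrow> real" where
  "Floc x n m w = (1 / real n) * (\<Sum>i<n. logloss (w \<bullet> x m i))"

definition Fglob :: "(nat \<Rightarrow> nat \<Rightarrow> 'a::euclidean_space) \<Rightarrow> nat \<Rightarrow> nat \<Rightarrow> 'a \<Rightarrow> real" where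
  "Fglob x M n w = (1 / real M) * (\<Sum>m<M. Floc x n m w)"

definition max_margin :: "(nat \<Rightarrow> nat \<Rightarrow> 'a::euclidean_space) \<Rightarrow> nat \<Rightarrow> nat \<Rightarrow> real" where
  "max_margin x M n =
     (SUP w\<in>{w. norm w = 1}. Min {w \<bullet> x m i | m i. m < M \<and> i < n})"

definition local_steps :: "(nat \<Rightarrow> nat \<Rightarrow> 'a::euclidean_space) \<Rightarrow> nat \<Rightarrow> real \<Rightarrow> nat \<Rightarrow> nat \<Rightarrow> 'a \<Rightarrow> 'a" where
  "local_steps x n \<eta> m k v = ((\<lambda>u. u - \<eta> *\<^sub>R grad (Floc x n m) u) ^^ k) v"

primrec localGD :: "(nat \<Rightarrow> nat \<Rightarrow> 'a::euclidean_space) \<Rightarrow> nat \<Rightarrow> nat \<Rightarrow> real \<Rightarrow> nat \<Rightarrow> 'a \<Rightarrow> nat \<Rightarrow> 'a" where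
  "localGD x M n \<eta> K w0 0 = w0"
| "localGD x M n \<eta> K w0 (Suc r) =
     (1 / real M) *\<^sub>R (\<Sum>m<M. local_steps x n \<eta> m K (localGD x M n \<eta> K w0 r))"

end

theory Submission
  imports Defs
begin

text \<open>
  Let \<open>w\<^sub>*\<close> be the maximum margin direction.  As long as \<open>F(w\<^sub>r) > 5\<psi>\<close>, the squared distance of the
  iterates to the far comparator \<open>v = R w\<^sub>*\<close>, where \<open>R\<gamma> = 2\<Lambda> + \<eta>/2\<close>, drops by at least \<open>4\<eta>\<Lambda>\<psi>\<close> per round:
  a misclassified point pulls \<open>w\<close> towards \<open>v\<close> with weight at least \<open>2\<Lambda>\<close>, a point of margin at most \<open>\<Lambda>\<close>
  with weight at least \<open>\<Lambda>\<close>, and each gradient evaluation loses at most \<open>exp(-2\<Lambda>-1)\<close> on points whose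
  margin already exceeds \<open>2\<Lambda>\<close>; the term \<open>\<eta>/2\<close> in \<open>R\<gamma>\<close> pays for the squared gradient norm, so no bound
  on the step size is needed.  With \<open>\<Lambda> = log(\<surd>K/\<psi>) + \<gamma>\<parallel>w\<^sub>0\<parallel> + \<eta>/2\<close> this phase lasts at most \<open>\<tau>\<close> rounds.
  Once \<open>F(w\<^sub>r) \<le> 5\<psi>\<close>, the local iterates of a round move by at most \<open>\<gamma>/26\<close>.  Since \<open>-\<ell>'\<close> changes at most by
  a factor \<open>exp(t)\<close> under a shift by \<open>t\<close>, a round is a gradient step of size \<open>\<eta>K\<close> on \<open>F\<close> up to a relative
  error of \<open>1/25\<close>, and \<open>\<parallel>\<nabla>F\<parallel> \<ge> \<gamma>F/3\<close> makes \<open>1/F\<close> grow by at least \<open>\<eta>\<gamma>\<^sup>2K/10\<close> per round.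
\<close>

subsection \<open>The logistic loss\<close>

text \<open>Minus the derivative of \<open>logloss\<close>: the weight of a data point in the
  gradient.\<close>

definition slope :: "real \<Rightarrow> real" where
  "slope z = 1 / (1 + exp z)"

lemma slope_pos: "0 < slope z"
  unfolding slope_def by (simp add: add_pos_pos)

lemma slope_le_1: "slope z \<le> 1"
  unfolding slope_def by (simp add: add_pos_pos)

lemma slope_le_exp: "slope z \<le> exp (- z)"
  unfolding slope_def by (simp add: exp_minus divide_simps add_pos_pos)

lemma logloss_pos: "0 < logloss z"
  unfolding logloss_def by (rule ln_gt_zero) simp

lemma logloss_le_exp: "logloss z \<le> exp (- z)"
  unfolding logloss_def by (rule ln_add_one_self_le_self) simp

text \<open>As a function of the loss t alone the weight is 1 - exp(-t), so lower bounds on weights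
  become one-variable inequalities in the loss.\<close>

lemma slope_eq_logloss: "slope z = 1 - exp (- logloss z)"
proof -
  have "1 + exp (- z) > 0" by (simp add: add_pos_pos)
  then have "exp (- logloss z) = 1 / (1 + exp (- z))"
    unfolding logloss_def by (simp add: exp_minus inverse_eq_divide)
  moreover have "1 + exp z > 0" by (simp add: add_pos_pos)
  ultimately show ?thesis
    using \<open>1 + exp (- z) > 0\<close> unfolding slope_def
    by (simp only: exp_minus) (simp add: field_simps)
qed

lemma slope_le_logloss: "slope z \<le> logloss z"
  using exp_ge_add_one_self[of "- logloss z"] unfolding slope_eq_logloss by linarith

text \<open>After multiplication by exp t the claim reads exp t * (1 - c t) >= 1. Since t <= 1/c
  keeps 1 - c t nonnegative, exp t may be replaced by its quadratic Taylor bound; the last premise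
  is what remains.\<close>

lemma one_minus_exp_ge:
  fixes c t :: real
  assumes "0 \<le> t" and "t \<le> 1 / c" and "c > 0" and "0 \<le> (1 - c) + (1/2 - c) * t - c / 2 * t\<^sup>2"
  shows "c * t \<le> 1 - exp (- t)"
proof -
  have "1 \<le> 1 + t * ((1 - c) + (1/2 - c) * t - c / 2 * t\<^sup>2)"
    using assms by simp
  also have "\<dots> = (1 + t + t\<^sup>2 / 2) * (1 - c * t)"
    by (simp add: field_simps power2_eq_square)
  also have "\<dots> \<le> exp t * (1 - c * t)"
    using assms by (intro mult_right_mono exp_lower_Taylor_quadratic) (auto simp: field_simps)
  finally have "exp (- t) \<le> 1 - c * t"
    by (simp add: exp_minus divide_simps mult.commute)
  then show ?thesis by simp
qed

lemma slope_ge_logloss_1: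
  assumes "logloss z \<le> 1"
  shows "3 / 5 * logloss z \<le> slope z"
  unfolding slope_eq_logloss
proof (rule one_minus_exp_ge)
  \<comment> \<open>At c = 3/5 the quadratic vanishes at loss 1, hence this factorisation.\<close>
  have "0 \<le> (1 - logloss z) * (2/5 + 3/10 * logloss z)"
    using assms logloss_pos[of z] by (intro mult_nonneg_nonneg) auto
  also have "\<dots> = (1 - 3/5) + (1/2 - 3/5) * logloss z - 3/5 / 2 * (logloss z)\<^sup>2"
    by (simp add: field_simps power2_eq_square)
  finally show "0 \<le> (1 - 3/5) + (1/2 - 3/5) * logloss z - 3/5 / 2 * (logloss z)\<^sup>2" .
qed (use assms logloss_pos[of z] in auto)

text \<open>The range 5/2 is M n * 5 \<psi> at \<psi> = 1/(2 M n), the bound on individual losses in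
  the stable region.\<close>

lemma slope_ge_logloss_2:
  assumes "logloss z \<le> 5 / 2"
  shows "logloss z / 3 \<le> slope z"
proof -
  have "1 / 3 * logloss z \<le> 1 - exp (- logloss z)"
  proof (rule one_minus_exp_ge)
    have "logloss z * logloss z \<le> 5/2 * logloss z"
      using assms logloss_pos[of z] by (intro mult_right_mono) auto
    then show "0 \<le> (1 - 1/3) + (1/2 - 1/3) * logloss z - 1/3 / 2 * (logloss z)\<^sup>2"
      using assms by (simp add: power2_eq_square)
  qed (use assms logloss_pos[of z] in auto)
  then show ?thesis by (simp add: slope_eq_logloss)
qed

text \<open>Lowering the argument by s multiplies the weight by at most exp s. The error is relative
  to the weight, so gradient errors can be measured against the gradient itself.\<close>

lemma slope_perturb:
  assumes "\<bar>t\<bar> \<le> D"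
  shows "\<bar>slope (z + t) - slope z\<bar> \<le> (exp D - 1) * slope z"
proof -
  have mono: "slope (u - s) \<le> exp s * slope u" if "0 \<le> s" for u s :: real
  proof -
    have "1 + exp u \<le> exp s * (1 + exp (u - s))"
      using that by (simp add: algebra_simps flip: exp_add)
    moreover have "1 + exp u > 0" "1 + exp (u - s) > 0" by (simp_all add: add_pos_pos)
    ultimately show ?thesis unfolding slope_def by (simp add: divide_simps)
  qed
  have anti: "slope u \<le> slope v" if "v \<le> u" for u v :: real
    using that unfolding slope_def by (intro divide_left_mono) (auto simp: add_pos_pos)
  have D: "0 \<le> D" using assms by linarith
  have up: "slope (z + t) \<le> exp D * slope z"
    using anti[of "z - D" "z + t"] mono[OF D, of z] assms by linarith
  have "slope z \<le> exp D * slope (z + t)"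
    using anti[of "z + t - D" "z"] mono[OF D, of "z + t"] assms by linarith
  then have "slope z / exp D \<le> slope (z + t)"
    by (simp add: divide_simps mult.commute)
  \<comment> \<open>The lower factor exp(-D) is weakened to 2 - exp D, so that both sides deviate by
    exp D - 1.\<close>
  moreover have "(2 - exp D) * slope z \<le> slope z / exp D"
  proof -
    have "exp D + exp (- D) \<ge> 2"
      using exp_ge_add_one_self[of D] exp_ge_add_one_self[of "- D"] by linarith
    then have "(2 - exp D) * slope z \<le> exp (- D) * slope z"
      using slope_pos[of z] by (intro mult_right_mono) auto
    then show ?thesis by (simp add: exp_minus divide_simps)
  qed
  ultimately show ?thesis using up by (simp add: algebra_simps abs_le_iff)
qed

text \<open>Only z > B can make the product negative; there exp(-z) * (z - B) is largest at z = B +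
  1.\<close>

lemma slope_weight_ge: "- exp (- B - 1) \<le> slope z * (B - z)"
proof (cases "z \<le> B")
  case True
  then have "0 \<le> slope z * (B - z)" using slope_pos[of z] by simp
  then show ?thesis using exp_gt_zero[of "- B - 1"] by linarith
next
  case False
  then have "slope z * (z - B) \<le> exp (- z) * (z - B)"
    using slope_le_exp[of z] by (intro mult_right_mono) auto
  also have "\<dots> \<le> exp (- z) * exp (z - B - 1)"
    using exp_ge_add_one_self[of "z - B - 1"] by (intro mult_left_mono) auto
  also have "\<dots> = exp (- B - 1)" by (simp flip: exp_add)
  finally show ?thesis by (simp add: algebra_simps)
qed

lemma logloss_has_derivative:
  "(logloss has_real_derivative - slope z) (at z)"
proof -
  have "1 + exp (- z) > 0" "1 + exp z > 0" by (simp_all add: add_pos_pos)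
  then show ?thesis
    unfolding logloss_def [abs_def] slope_def
    by (auto intro!: derivative_eq_intros simp: exp_minus field_simps)
qed

text \<open>Jensen for exp at the points 0 and z - y with weights 1 - \<open>slope z\<close> and
  \<open>slope z\<close>, followed by a logarithm.\<close>

lemma logloss_convex: "logloss z - slope z * (y - z) \<le> logloss y"
proof -
  let ?p = "slope z" and ?t = "z - y"
  have "exp ((1 - ?p) *\<^sub>R 0 + ?p *\<^sub>R ?t) \<le> (1 - ?p) * exp 0 + ?p * exp ?t"
    using slope_pos[of z] slope_le_1[of z]
    by (intro convex_onD[OF exp_convex]) auto
  then have "exp (?p * ?t) \<le> 1 - ?p + ?p * exp ?t" by simp
  also have "\<dots> = (1 + exp (- y)) / (1 + exp (- z))"
  proof -
    have "1 + exp z > 0" "1 + exp (- z) > 0" by (simp_all add: add_pos_pos)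
    then show ?thesis
      unfolding slope_def by (simp add: exp_minus exp_diff divide_simps) (simp add: algebra_simps)
  qed
  finally have "?p * ?t \<le> ln ((1 + exp (- y)) / (1 + exp (- z)))"
    by (subst ln_ge_iff) (simp_all add: add_pos_pos)
  also have "\<dots> = logloss y - logloss z"
    unfolding logloss_def by (rule ln_divide_pos) (simp_all add: add_pos_pos)
  finally show ?thesis by (simp add: algebra_simps)
qed

subsection \<open>Averages over the data\<close>

definition mean2 :: "nat \<Rightarrow> nat \<Rightarrow> (nat \<Rightarrow> nat \<Rightarrow> real) \<Rightarrow> real" where
  "mean2 M n f = (1 / real M) * (\<Sum>m<M. (1 / real n) * (\<Sum>i<n. f m i))"

lemma Fglob_eq_mean2: "Fglob x M n w = mean2 M n (\<lambda>m i. logloss (w \<bullet> x m i))"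
  by (simp add: Fglob_def Floc_def mean2_def)

lemma mean2_mono:
  assumes "\<And>m i. m < M \<Longrightarrow> i < n \<Longrightarrow> f m i \<le> g m i"
  shows "mean2 M n f \<le> mean2 M n g"
  unfolding mean2_def using assms by (intro mult_left_mono sum_mono) auto

lemma mean2_affine:
  assumes "M > 0" "n > 0"
  shows "mean2 M n (\<lambda>m i. a * f m i + b) = a * mean2 M n f + b"
proof -
  have "(1 / real n) * (\<Sum>i<n. a * f m i + b) = a * ((1 / real n) * (\<Sum>i<n. f m i)) + b" for m
    using assms by (simp add: sum.distrib field_simps flip: sum_distrib_left)
  then show ?thesis
    using assms by (simp add: mean2_def sum.distrib field_simps flip: sum_distrib_left sum_divide_distrib)
qed

text \<open>Passes from averages to single points; the factor M n is absorbed by \<psi> <= 1/(2 M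
  n).\<close>

lemma mean2_member:
  assumes "\<And>m i. m < M \<Longrightarrow> i < n \<Longrightarrow> 0 \<le> f m i" "m < M" "i < n"
  shows "f m i \<le> real M * real n * mean2 M n f"
proof -
  have "f m i \<le> (\<Sum>i<n. f m i)"
    using assms by (intro member_le_sum) auto
  also have "\<dots> \<le> (\<Sum>m<M. \<Sum>i<n. f m i)"
    using assms by (intro member_le_sum sum_nonneg) auto
  also have "\<dots> = real M * real n * mean2 M n f"
    using assms unfolding mean2_def sum_distrib_left[symmetric] by simp
  finally show ?thesis .
qed

lemma norm_avg_le:
  fixes y :: "nat \<Rightarrow> 'a::real_normed_vector"
  assumes "M > 0" "\<And>m. m < M \<Longrightarrow> norm (y m) \<le> b m"
  shows "norm ((1 / real M) *\<^sub>R (\<Sum>m<M. y m)) \<le> (1 / real M) * (\<Sum>m<M. b m)"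
  using assms by (auto intro!: divide_right_mono sum_norm_le)

lemma norm_avg_sq_le:
  fixes y :: "nat \<Rightarrow> 'a::real_normed_vector"
  assumes "M > 0"
  shows "(norm ((1 / real M) *\<^sub>R (\<Sum>m<M. y m)))\<^sup>2 \<le> (1 / real M) * (\<Sum>m<M. (norm (y m))\<^sup>2)"
proof -
  have "(norm ((1 / real M) *\<^sub>R (\<Sum>m<M. y m)))\<^sup>2 \<le> ((1 / real M) * (\<Sum>m<M. norm (y m)))\<^sup>2"
    using assms by (intro power_mono norm_avg_le) auto
  also have "\<dots> \<le> (1 / real M)\<^sup>2 * ((\<Sum>m<M. (norm (y m))\<^sup>2) * card {..<M})"
    unfolding power_mult_distrib
    by (intro mult_left_mono sum_squared_le_sum_of_squares) auto
  also have "\<dots> = (1 / real M) * (\<Sum>m<M. (norm (y m))\<^sup>2)"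
    using assms by (simp add: power2_eq_square)
  finally show ?thesis .
qed

text \<open>Discrete form of f' = -c f^2: multiply by 1 + c f and use (1 + c f)(1 - c f) <=
  1.\<close>

lemma inverse_descent:
  fixes f f' c :: real
  assumes "0 < f'" "f' \<le> f - c * f\<^sup>2" "0 \<le> c" "0 < f"
  shows "1 / f + c \<le> 1 / f'"
proof -
  have "(1 + c * f) * f' \<le> (1 + c * f) * (f * (1 - c * f))"
    using assms by (intro mult_left_mono) (auto simp: algebra_simps power2_eq_square)
  also have "\<dots> = f * (1 - (c * f)\<^sup>2)" by (simp add: algebra_simps power2_eq_square)
  also have "\<dots> \<le> f * 1" using assms by (intro mult_left_mono) auto
  finally show ?thesis using assms by (simp add: field_simps)
qed

subsection \<open>Separable data\<close>

lemma grad_eqI: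
  assumes "(f has_derivative (\<lambda>h. g \<bullet> h)) (at w)"
  shows "grad f w = g"
  unfolding grad_def
proof (rule the_equality)
  fix g' assume "(f has_derivative (\<lambda>h. g' \<bullet> h)) (at w)"
  then have "(\<lambda>h. g' \<bullet> h) = (\<lambda>h. g \<bullet> h)"
    using assms by (rule has_derivative_unique)
  then show "g' = g"
    by (metis inner_commute vector_eq_ldot)
qed (fact assms)

lemma grad_Floc:
  "grad (Floc x n m) w = - ((1 / real n) *\<^sub>R (\<Sum>i<n. slope (w \<bullet> x m i) *\<^sub>R x m i))"
proof (rule grad_eqI)
  have der: "((\<lambda>w. logloss (w \<bullet> x m i)) has_derivative
          (\<lambda>h. - slope (w \<bullet> x m i) * (h \<bullet> x m i))) (at w)" for i
  proof -
    have "((\<lambda>w. w \<bullet> x m i) has_derivative (\<lambda>h. h \<bullet> x m i)) (at w)"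
      by (auto intro!: derivative_eq_intros)
    then show ?thesis
      using logloss_has_derivative[of "w \<bullet> x m i"]
      unfolding has_field_derivative_def by (rule has_derivative_compose)
  qed
  show "(Floc x n m has_derivative
      (\<lambda>h. - ((1 / real n) *\<^sub>R (\<Sum>i<n. slope (w \<bullet> x m i) *\<^sub>R x m i)) \<bullet> h)) (at w)"
    unfolding Floc_def [abs_def]
    by (rule has_derivative_eq_rhs, rule has_derivative_mult_right, rule has_derivative_sum, rule der)
       (simp add: inner_sum_right sum_negf inner_commute[of _ h for h] fun_eq_iff)
qed

text \<open>The analysis only uses some unit vector \<open>ws\<close> of margin at least \<gamma>;
  \<open>max_margin\<close> enters when the locale is instantiated.\<close>

locale separable_data =
  fixes x :: "nat \<Rightarrow> nat \<Rightarrow> 'a::euclidean_space"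
    and M n :: nat and \<gamma> :: real and ws :: 'a
  assumes M_pos: "M > 0" and n_pos: "n > 0"
    and norm_x: "m < M \<Longrightarrow> i < n \<Longrightarrow> norm (x m i) \<le> 1"
    and norm_ws: "norm ws = 1"
    and margin: "m < M \<Longrightarrow> i < n \<Longrightarrow> \<gamma> \<le> ws \<bullet> x m i"
    and \<gamma>_pos: "0 < \<gamma>"
begin

lemma \<gamma>_le_1: "\<gamma> \<le> 1"
proof -
  have "\<gamma> \<le> ws \<bullet> x 0 0" using margin M_pos n_pos by blast
  also have "\<dots> \<le> norm ws * norm (x 0 0)" by (rule norm_cauchy_schwarz)
  also have "\<dots> \<le> 1" using norm_x[of 0 0] norm_ws M_pos n_pos by simp
  finally show ?thesis .
qed

text \<open>Average weight of one client's points. It controls the client gradient from both sides: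
  \<gamma> * \<open>mass\<close> <= norm of the gradient <= \<open>mass\<close>.\<close>

definition mass :: "nat \<Rightarrow> 'a \<Rightarrow> real" where
  "mass m w = (1 / real n) * (\<Sum>i<n. slope (w \<bullet> x m i))"

abbreviation total_mass :: "'a \<Rightarrow> real" where
  "total_mass w \<equiv> mean2 M n (\<lambda>m i. slope (w \<bullet> x m i))"

lemma total_mass_eq: "total_mass w = (1 / real M) * (\<Sum>m<M. mass m w)"
  by (simp add: mean2_def mass_def)

lemma mass_nonneg: "0 \<le> mass m w"
  unfolding mass_def by (intro mult_nonneg_nonneg sum_nonneg) (auto simp: slope_pos less_imp_le)

lemma mass_le_1: "mass m w \<le> 1"
proof -
  have "(\<Sum>i<n. slope (w \<bullet> x m i)) \<le> (\<Sum>i<n. 1)"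
    by (intro sum_mono slope_le_1)
  then show ?thesis using n_pos unfolding mass_def by (simp add: divide_simps)
qed

lemma mass_le_Floc: "mass m w \<le> Floc x n m w"
  unfolding mass_def Floc_def by (intro mult_left_mono sum_mono slope_le_logloss) auto

lemma inner_grad:
  "grad (Floc x n m) w \<bullet> h = - ((1 / real n) * (\<Sum>i<n. slope (w \<bullet> x m i) * (h \<bullet> x m i)))"
  by (simp add: grad_Floc inner_sum_right inner_commute[of _ h])

lemma norm_grad_le:
  assumes "m < M"
  shows "norm (grad (Floc x n m) w) \<le> mass m w"
  unfolding grad_Floc mass_def norm_minus_cancel
proof (intro norm_avg_le n_pos)
  fix i assume "i < n"
  then show "norm (slope (w \<bullet> x m i) *\<^sub>R x m i) \<le> slope (w \<bullet> x m i)"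
    using norm_x[OF assms] slope_pos[of "w \<bullet> x m i"] by (simp add: mult_left_le)
qed

lemma grad_margin:
  assumes "m < M"
  shows "\<gamma> * mass m w \<le> - (grad (Floc x n m) w \<bullet> ws)"
proof -
  have "\<gamma> * mass m w = (1 / real n) * (\<Sum>i<n. slope (w \<bullet> x m i) * \<gamma>)"
    by (simp add: mass_def sum_distrib_left sum_distrib_right mult_ac)
  also have "\<dots> \<le> (1 / real n) * (\<Sum>i<n. slope (w \<bullet> x m i) * (ws \<bullet> x m i))"
    using assms by (intro mult_left_mono sum_mono margin) (auto simp: slope_pos less_imp_le)
  finally show ?thesis by (simp add: inner_grad)
qed

lemma grad_perturb:
  assumes "m < M" "norm h \<le> D"
  shows "norm (grad (Floc x n m) (w + h) - grad (Floc x n m) w) \<le> (exp D - 1) * mass m w"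
proof -
  have "grad (Floc x n m) (w + h) - grad (Floc x n m) w =
      - ((1 / real n) *\<^sub>R (\<Sum>i<n. (slope ((w + h) \<bullet> x m i) - slope (w \<bullet> x m i)) *\<^sub>R x m i))"
    by (simp add: grad_Floc scaleR_left_diff_distrib sum_subtractf scaleR_right_diff_distrib)
  also have "norm \<dots> \<le> (1 / real n) * (\<Sum>i<n. (exp D - 1) * slope (w \<bullet> x m i))"
    unfolding norm_minus_cancel
  proof (intro norm_avg_le n_pos)
    fix i assume i: "i < n"
    have "\<bar>h \<bullet> x m i\<bar> \<le> norm h * norm (x m i)" by (rule Cauchy_Schwarz_ineq2)
    also have "\<dots> \<le> D"
      using norm_x[OF assms(1) i] assms(2) mult_left_le[of "norm (x m i)" "norm h"]
      by (auto intro: order_trans)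
    finally have "\<bar>slope ((w + h) \<bullet> x m i) - slope (w \<bullet> x m i)\<bar> \<le> (exp D - 1) * slope (w \<bullet> x m i)"
      unfolding inner_add_left by (rule slope_perturb)
    moreover have "norm ((slope ((w + h) \<bullet> x m i) - slope (w \<bullet> x m i)) *\<^sub>R x m i)
        \<le> \<bar>slope ((w + h) \<bullet> x m i) - slope (w \<bullet> x m i)\<bar>"
      using norm_x[OF assms(1) i] by (simp add: mult_left_le)
    ultimately show "norm ((slope ((w + h) \<bullet> x m i) - slope (w \<bullet> x m i)) *\<^sub>R x m i)
        \<le> (exp D - 1) * slope (w \<bullet> x m i)" by linarith
  qed
  also have "\<dots> = (exp D - 1) * mass m w"
    by (simp add: mass_def sum_distrib_left mult_ac)
  finally show ?thesis .
qed

lemma Floc_convex: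
  "Floc x n m w + grad (Floc x n m) w \<bullet> (v - w) \<le> Floc x n m v"
proof -
  have "Floc x n m w + grad (Floc x n m) w \<bullet> (v - w) =
     (1 / real n) * (\<Sum>i<n. logloss (w \<bullet> x m i) - slope (w \<bullet> x m i) * (v \<bullet> x m i - w \<bullet> x m i))"
    by (simp add: Floc_def inner_grad sum_subtractf inner_diff_left right_diff_distrib)
  also have "\<dots> \<le> Floc x n m v"
    unfolding Floc_def by (intro mult_left_mono sum_mono logloss_convex) auto
  finally show ?thesis .
qed


section \<open>Local steps and the averaged round\<close>

abbreviation gd_round :: "real \<Rightarrow> nat \<Rightarrow> 'a \<Rightarrow> 'a" where
  "gd_round \<eta> K w \<equiv> (1 / real M) *\<^sub>R (\<Sum>m<M. local_steps x n \<eta> m K w)"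

lemma local_steps_Suc:
  "local_steps x n \<eta> m (Suc k) w =
     local_steps x n \<eta> m k w - \<eta> *\<^sub>R grad (Floc x n m) (local_steps x n \<eta> m k w)"
  by (simp add: local_steps_def)

lemma local_steps_0: "local_steps x n \<eta> m 0 w = w"
  by (simp add: local_steps_def)

subsection \<open>Leaving the unstable region\<close>

text \<open>
  For \<open>u\<close> with \<open>u \<bullet> x m i \<ge> B\<close> for all \<open>i\<close>, \<open>gain m B w\<close> bounds the
  inner product of the negative gradient at \<open>w\<close> with \<open>u - w\<close> from below.
\<close>

definition gain :: "nat \<Rightarrow> real \<Rightarrow> 'a \<Rightarrow> real" where
  "gain m B w = (1 / real n) * (\<Sum>i<n. slope (w \<bullet> x m i) * (B - w \<bullet> x m i))"

lemma gain_ge: "- exp (- B - 1) \<le> gain m B w"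
proof -
  have "(1 / real n) * (\<Sum>i<n. - exp (- B - 1)) \<le> gain m B w"
    unfolding gain_def by (intro mult_left_mono sum_mono slope_weight_ge) auto
  then show ?thesis using n_pos by simp
qed

text \<open>Expand the square. The comparator has margin at least B + \<eta>/2 on every point; B
  yields the gain, and \<eta>/2 yields \<eta>^2 * \<open>mass\<close>, which covers the squared
  gradient because \<open>mass\<close> <= 1 gives \<open>mass\<close>^2 <=
  \<open>mass\<close>.\<close>

lemma gradient_step_dist:
  assumes "m < M" "0 < \<eta>" "0 \<le> R" "B + \<eta> / 2 \<le> R * \<gamma>"
  shows "(norm (w - \<eta> *\<^sub>R grad (Floc x n m) w - R *\<^sub>R ws))\<^sup>2
           \<le> (norm (w - R *\<^sub>R ws))\<^sup>2 - 2 * \<eta> * gain m B w"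
proof -
  define g where "g = grad (Floc x n m) w"
  define a where "a = w - R *\<^sub>R ws"
  have gw: "g \<bullet> w = gain m B w - B * mass m w"
    unfolding g_def inner_grad gain_def mass_def
    by (simp add: right_diff_distrib sum_subtractf sum_distrib_left mult_ac)
  have "(B + \<eta> / 2) * mass m w \<le> R * (\<gamma> * mass m w)"
    using mult_right_mono[OF assms(4) mass_nonneg[of m w]] by (simp add: mult_ac)
  also have "\<dots> \<le> R * - (g \<bullet> ws)"
    unfolding g_def using assms by (intro mult_left_mono grad_margin) auto
  finally have "gain m B w + \<eta> / 2 * mass m w \<le> g \<bullet> a"
    unfolding a_def inner_diff_right gw by (simp add: algebra_simps)
  then have ga: "2 * \<eta> * gain m B w + \<eta>\<^sup>2 * mass m w \<le> 2 * \<eta> * (g \<bullet> a)"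
    using mult_left_mono[of "gain m B w + \<eta> / 2 * mass m w" "g \<bullet> a" "2 * \<eta>"] assms
    by (simp add: algebra_simps power2_eq_square)
  have "(norm g)\<^sup>2 \<le> (mass m w)\<^sup>2"
    unfolding g_def using assms by (intro power_mono norm_grad_le) auto
  also have "\<dots> \<le> mass m w"
    unfolding power2_eq_square using mass_nonneg mass_le_1 by (intro mult_left_le) auto
  finally have "\<eta>\<^sup>2 * (norm g)\<^sup>2 \<le> \<eta>\<^sup>2 * mass m w"
    by (intro mult_left_mono) auto
  moreover have "(norm (a - \<eta> *\<^sub>R g))\<^sup>2 = (norm a)\<^sup>2 - 2 * \<eta> * (g \<bullet> a) + \<eta>\<^sup>2 * (norm g)\<^sup>2"
    unfolding power2_norm_eq_inner
    by (simp add: inner_diff_left inner_diff_right inner_commute algebra_simps power2_eq_square)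
  moreover have "a - \<eta> *\<^sub>R g = w - \<eta> *\<^sub>R grad (Floc x n m) w - R *\<^sub>R ws"
    by (simp add: a_def g_def)
  ultimately show ?thesis using ga unfolding a_def by simp
qed

text \<open>Only the gain of the first step is kept, since all clients take it at the common point
  w. Each later step costs at most 2 \<eta> exp(-B - 1) by \<open>gain_ge\<close>.\<close>

lemma local_steps_dist:
  assumes "m < M" "0 < \<eta>" "0 \<le> R" "B + \<eta> / 2 \<le> R * \<gamma>"
  shows "(norm (local_steps x n \<eta> m (Suc k) w - R *\<^sub>R ws))\<^sup>2
           \<le> (norm (w - R *\<^sub>R ws))\<^sup>2 - 2 * \<eta> * gain m B w + 2 * \<eta> * real k * exp (- B - 1)"
proof (induction k)
  case 0
  then show ?case using gradient_step_dist[OF assms] by (simp add: local_steps_Suc local_steps_0)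
next
  case (Suc k)
  define u where "u = local_steps x n \<eta> m (Suc k) w"
  have "(norm (local_steps x n \<eta> m (Suc (Suc k)) w - R *\<^sub>R ws))\<^sup>2
      \<le> (norm (u - R *\<^sub>R ws))\<^sup>2 - 2 * \<eta> * gain m B u"
    unfolding local_steps_Suc[of \<eta> m "Suc k"] u_def by (rule gradient_step_dist[OF assms])
  moreover have "2 * \<eta> * - exp (- B - 1) \<le> 2 * \<eta> * gain m B u"
    using assms by (intro mult_left_mono gain_ge) auto
  moreover have "2 * \<eta> * real (Suc k) * exp (- B - 1)
      = 2 * \<eta> * real k * exp (- B - 1) - 2 * \<eta> * - exp (- B - 1)"
    by (simp add: distrib_left distrib_right)
  ultimately show ?case using Suc[folded u_def] by linarith
qed

lemma gd_round_dist:
  assumes "0 < \<eta>" "0 < K" "0 \<le> R" "B + \<eta> / 2 \<le> R * \<gamma>"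
  shows "(norm (gd_round \<eta> K w - R *\<^sub>R ws))\<^sup>2 \<le> (norm (w - R *\<^sub>R ws))\<^sup>2
           - 2 * \<eta> * mean2 M n (\<lambda>m i. slope (w \<bullet> x m i) * (B - w \<bullet> x m i))
           + 2 * \<eta> * (real K - 1) * exp (- B - 1)"
proof -
  let ?y = "\<lambda>m. local_steps x n \<eta> m K w - R *\<^sub>R ws"
  let ?c = "(norm (w - R *\<^sub>R ws))\<^sup>2 + 2 * \<eta> * (real K - 1) * exp (- B - 1)"
  have "gd_round \<eta> K w - R *\<^sub>R ws = (1 / real M) *\<^sub>R (\<Sum>m<M. ?y m)"
    using M_pos by (simp add: sum_subtractf scaleR_right_diff_distrib sum_constant_scaleR)
  then have "(norm (gd_round \<eta> K w - R *\<^sub>R ws))\<^sup>2 \<le> (1 / real M) * (\<Sum>m<M. (norm (?y m))\<^sup>2)"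
    using norm_avg_sq_le[OF M_pos, of ?y] by simp
  also have "\<dots> \<le> (1 / real M) * (\<Sum>m<M. ?c - 2 * \<eta> * gain m B w)"
  proof (intro mult_left_mono sum_mono)
    fix m assume "m \<in> {..<M}"
    then show "(norm (?y m))\<^sup>2 \<le> ?c - 2 * \<eta> * gain m B w"
      using local_steps_dist[OF _ assms(1,3,4), of m "K - 1" w] assms(2) by simp
  qed auto
  also have "\<dots> = ?c - 2 * \<eta> * ((1 / real M) * (\<Sum>m<M. gain m B w))"
    using M_pos by (simp only: sum_subtractf sum_constant flip: sum_distrib_left) (simp add: field_simps)
  also have "(1 / real M) * (\<Sum>m<M. gain m B w) = mean2 M n (\<lambda>m i. slope (w \<bullet> x m i) * (B - w \<bullet> x m i))"
    by (simp add: mean2_def gain_def)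
  finally show ?thesis by simp
qed

text \<open>If all losses are at most 1, each point gains at least 3/5 \<Lambda> (loss - \<psi>) up
  to the shift, and averaging with F > 5 \<psi> gives 3/5 * 4 = 12/5. Otherwise one point of loss
  above 1 alone gains 6/5 \<Lambda>, which survives division by M n because 2 M n \<psi> <=
  1.\<close>

lemma mean_gain_ge:
  assumes "0 < \<psi>" "\<psi> \<le> 1 / (2 * real M * real n)" "1 / 2 \<le> \<Lambda>" "exp (- \<Lambda>) \<le> \<psi>"
    and F: "5 * \<psi> < Fglob x M n w"
  shows "12 / 5 * \<Lambda> * \<psi> - exp (- (2 * \<Lambda>) - 1)
           \<le> mean2 M n (\<lambda>m i. slope (w \<bullet> x m i) * (2 * \<Lambda> - w \<bullet> x m i))"
proof -
  define q where "q z = slope z * (2 * \<Lambda> - z)" for z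
  define \<epsilon> where "\<epsilon> = exp (- (2 * \<Lambda>) - 1)"
  have q_ge: "0 \<le> q z + \<epsilon>" for z
    using slope_weight_ge[of "2 * \<Lambda>" z] by (simp add: q_def \<epsilon>_def)
  have \<epsilon>0: "0 < \<epsilon>" by (simp add: \<epsilon>_def)
  \<comment> \<open>Adding \<epsilon> makes every summand nonnegative, so that a single point can be
    compared with the mean.\<close>
  have shift: "mean2 M n (\<lambda>m i. q (w \<bullet> x m i) + \<epsilon>) = mean2 M n (\<lambda>m i. q (w \<bullet> x m i)) + \<epsilon>"
    using mean2_affine[OF M_pos n_pos, of 1 _ \<epsilon>] by simp
  have "12 / 5 * \<Lambda> * \<psi> \<le> mean2 M n (\<lambda>m i. q (w \<bullet> x m i) + \<epsilon>)"
  proof (cases "\<forall>m<M. \<forall>i<n. logloss (w \<bullet> x m i) \<le> 1")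
    case True
    have pointwise: "3 / 5 * \<Lambda> * logloss z + - (3 / 5 * \<Lambda> * \<psi>) \<le> q z + \<epsilon>" if "logloss z \<le> 1" for z
    proof (cases "z \<le> \<Lambda>")
      case True
      have "(3 / 5 * logloss z) * \<Lambda> \<le> slope z * (2 * \<Lambda> - z)"
        using slope_ge_logloss_1[OF that] True slope_pos[of z] assms by (intro mult_mono) auto
      moreover have "0 \<le> 3 / 5 * \<Lambda> * \<psi>" using assms by simp
      moreover have "3 / 5 * \<Lambda> * logloss z = (3 / 5 * logloss z) * \<Lambda>" by simp
      ultimately show ?thesis using \<epsilon>0 unfolding q_def by linarith
    next
      case False
      have "logloss z \<le> exp (- z)" by (rule logloss_le_exp)
      also have "\<dots> \<le> exp (- \<Lambda>)" using False by simp
      finally have "3 / 5 * \<Lambda> * logloss z \<le> 3 / 5 * \<Lambda> * \<psi>"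
        using assms by (intro mult_left_mono) auto
      then show ?thesis using q_ge[of z] by linarith
    qed
    have "12 / 5 * \<Lambda> * \<psi> = 3 / 5 * \<Lambda> * (5 * \<psi>) + - (3 / 5 * \<Lambda> * \<psi>)" by simp
    also have "\<dots> \<le> 3 / 5 * \<Lambda> * Fglob x M n w + - (3 / 5 * \<Lambda> * \<psi>)"
      using assms by (intro add_mono mult_left_mono) auto
    also have "\<dots> = mean2 M n (\<lambda>m i. 3 / 5 * \<Lambda> * logloss (w \<bullet> x m i) + - (3 / 5 * \<Lambda> * \<psi>))"
      unfolding Fglob_eq_mean2 by (rule mean2_affine[OF M_pos n_pos, symmetric])
    also have "\<dots> \<le> mean2 M n (\<lambda>m i. q (w \<bullet> x m i) + \<epsilon>)"
      using True by (intro mean2_mono pointwise) auto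
    finally show ?thesis .
  next
    case False
    then obtain m i where mi: "m < M" "i < n" and big: "1 < logloss (w \<bullet> x m i)"
      by (auto simp: not_le)
    define z where "z = w \<bullet> x m i"
    have p: "3 / 5 \<le> slope z"
    proof -
      have "exp (- logloss z) \<le> exp (- 1)" using big by (simp add: z_def)
      also have "\<dots> \<le> 2 / 5"
        using exp_lower_Taylor_quadratic[of 1] by (simp add: exp_minus divide_simps)
      finally show ?thesis unfolding slope_eq_logloss by simp
    qed
    have "z \<le> 0"
    proof (rule ccontr)
      assume "\<not> z \<le> 0"
      then have "exp (- z) \<le> 1" by simp
      then show False using logloss_le_exp[of z] big unfolding z_def by linarith
    qed
    then have "3 / 5 * (2 * \<Lambda>) \<le> q z"
      unfolding q_def using p assms by (intro mult_mono) auto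
    also have "\<dots> \<le> q z + \<epsilon>" using \<epsilon>0 by simp
    also have "\<dots> \<le> real M * real n * mean2 M n (\<lambda>m i. q (w \<bullet> x m i) + \<epsilon>)"
      unfolding z_def by (rule mean2_member[OF _ mi]) (rule q_ge)
    finally have 1: "6 / 5 * \<Lambda> \<le> real M * real n * mean2 M n (\<lambda>m i. q (w \<bullet> x m i) + \<epsilon>)" by simp
    have MN: "0 < real M * real n" using M_pos n_pos by simp
    have "2 * (real M * real n) * \<psi> \<le> 1"
      using assms(2) MN by (simp add: field_simps)
    then have "real M * real n * (12 / 5 * \<Lambda> * \<psi>) \<le> 6 / 5 * \<Lambda>"
      using assms(3) mult_left_mono[of "2 * (real M * real n) * \<psi>" 1 "6 / 5 * \<Lambda>"] by (simp add: mult_ac)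
    then show ?thesis using 1 MN by (meson mult_le_cancel_left_pos order_trans)
  qed
  then show ?thesis unfolding shift by (simp add: q_def \<epsilon>_def)
qed

text \<open>One \<epsilon> is lost in \<open>mean_gain_ge\<close> and K - 1 in the later local
  steps. Together they cost at most 2/5 \<Lambda> \<psi>, leaving 12/5 - 2/5 = 2 times \<Lambda>
  \<psi>, which the factor 2 \<eta> turns into the stated decrease.\<close>

lemma unstable_round:
  assumes "0 < \<eta>" "0 < K" "0 < \<psi>" "\<psi> \<le> 1 / (2 * real M * real n)"
    and \<Lambda>: "real K * exp (- (2 * \<Lambda>)) \<le> \<psi>\<^sup>2"
    and "0 \<le> R" "R * \<gamma> = 2 * \<Lambda> + \<eta> / 2" "5 * \<psi> < Fglob x M n w"
  shows "(norm (gd_round \<eta> K w - R *\<^sub>R ws))\<^sup>2 \<le> (norm (w - R *\<^sub>R ws))\<^sup>2 - 4 * \<eta> * \<Lambda> * \<psi>"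
proof -
  let ?\<epsilon> = "exp (- (2 * \<Lambda>) - 1)"
  let ?g = "mean2 M n (\<lambda>m i. slope (w \<bullet> x m i) * (2 * \<Lambda> - w \<bullet> x m i))"
  have "(exp (- \<Lambda>))\<^sup>2 \<le> real K * exp (- (2 * \<Lambda>))"
    using assms(2) by (simp add: power2_eq_square flip: exp_add)
  then have e: "exp (- \<Lambda>) \<le> \<psi>"
    using \<Lambda> assms(3) by (meson less_imp_le order_trans power2_le_imp_le)
  have "1 \<le> real M * real n" using M_pos n_pos by (simp flip: of_nat_mult)
  then have "1 / (2 * real M * real n) \<le> 1 / 2" by (simp add: field_simps)
  then have \<psi>: "\<psi> \<le> 1 / 2" using assms(4) by linarith
  \<comment> \<open>From 1 - \<Lambda> <= exp(-\<Lambda>) <= \<psi> <= 1/2.\<close>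
  then have half: "1 / 2 \<le> \<Lambda>"
    using e exp_ge_add_one_self[of "- \<Lambda>"] by linarith
  have "real K * ?\<epsilon> = real K * exp (- (2 * \<Lambda>)) * exp (- 1)"
    by (simp add: exp_diff exp_minus field_simps)
  also have "\<dots> \<le> \<psi>\<^sup>2 * (2 / 5)"
    using exp_lower_Taylor_quadratic[of 1] \<Lambda>
    by (intro mult_mono) (auto simp: exp_minus divide_simps)
  also have "\<dots> \<le> 2 / 5 * \<Lambda> * \<psi>"
    using \<psi> half assms(3) by (simp add: power2_eq_square)
  finally have K\<epsilon>: "real K * ?\<epsilon> \<le> 2 / 5 * \<Lambda> * \<psi>" .
  have "12 / 5 * \<Lambda> * \<psi> - ?\<epsilon> \<le> ?g"
    using mean_gain_ge[OF assms(3,4) half e assms(8)] .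
  then have "2 * \<Lambda> * \<psi> \<le> ?g - (real K - 1) * ?\<epsilon>"
    using K\<epsilon> by (simp add: algebra_simps)
  then have "2 * \<eta> * (2 * \<Lambda> * \<psi>) \<le> 2 * \<eta> * (?g - (real K - 1) * ?\<epsilon>)"
    using assms(1) by (intro mult_left_mono) auto
  then show ?thesis
    using gd_round_dist[OF assms(1,2,6), of "2 * \<Lambda>" w] assms(7) by (simp add: algebra_simps)
qed

lemma unstable_time:
  assumes "0 < \<eta>" "0 < K" "0 < \<psi>" "\<psi> \<le> 1 / (2 * real M * real n)"
    and "real K * exp (- (2 * \<Lambda>)) \<le> \<psi>\<^sup>2"
    and "0 \<le> R" "R * \<gamma> = 2 * \<Lambda> + \<eta> / 2"
    and "\<And>s. s < S \<Longrightarrow> 5 * \<psi> < Fglob x M n (localGD x M n \<eta> K w0 s)"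
  shows "real S * (4 * \<eta> * \<Lambda> * \<psi>) \<le> (norm (w0 - R *\<^sub>R ws))\<^sup>2"
proof -
  have "(norm (localGD x M n \<eta> K w0 S - R *\<^sub>R ws))\<^sup>2
      \<le> (norm (w0 - R *\<^sub>R ws))\<^sup>2 - real S * (4 * \<eta> * \<Lambda> * \<psi>)"
    using assms(8)
  proof (induction S)
    case (Suc S)
    then show ?case
      using unstable_round[OF assms(1-7), of "localGD x M n \<eta> K w0 S"] by (simp add: algebra_simps)
  qed simp
  then show ?thesis using zero_le_power2[of "norm (localGD x M n \<eta> K w0 S - R *\<^sub>R ws)"] by linarith
qed

subsection \<open>The stable region\<close>

lemma exp_small: "exp (\<gamma> / 26) - 1 \<le> \<gamma> / 25"
proof -
  have "(1 - \<gamma> / 26) * exp (\<gamma> / 26) \<le> exp (- (\<gamma> / 26)) * exp (\<gamma> / 26)"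
    using exp_ge_add_one_self[of "- (\<gamma> / 26)"] by (intro mult_right_mono) auto
  then have 1: "(1 - \<gamma> / 26) * exp (\<gamma> / 26) \<le> 1" by (simp flip: exp_add)
  have "\<gamma> * \<gamma> \<le> \<gamma>" using \<gamma>_pos \<gamma>_le_1 by (simp add: mult_left_le)
  \<comment> \<open>The gap 1/25 - 1/26 equals 1/(25 * 26), so this reduces to \<gamma>^2 <=
    \<gamma>.\<close>
  then have "1 \<le> (1 - \<gamma> / 26) * (1 + \<gamma> / 25)" by (simp add: field_simps)
  then have "(1 - \<gamma> / 26) * exp (\<gamma> / 26) \<le> (1 - \<gamma> / 26) * (1 + \<gamma> / 25)" using 1 by linarith
  then have "exp (\<gamma> / 26) \<le> 1 + \<gamma> / 25"
    using \<gamma>_le_1 by (subst (asm) mult_le_cancel_left_pos) auto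
  then show ?thesis by simp
qed

lemma grad_perturb_small:
  assumes "m < M" "norm h \<le> \<gamma> / 26"
  shows "norm (grad (Floc x n m) (w + h) - grad (Floc x n m) w) \<le> \<gamma> / 25 * mass m w"
  using grad_perturb[OF assms, of w] mult_right_mono[OF exp_small mass_nonneg[of m w]] by linarith

text \<open>The error enlarges the gradient displacement by at most a 25th, and 26/25 * \<gamma>/28
  <= \<gamma>/26.\<close>

lemma norm_le_drift:
  assumes "m < M" "0 \<le> c" "c * mass m w \<le> \<gamma> / 28"
    and "norm (h + c *\<^sub>R grad (Floc x n m) w) \<le> c * (\<gamma> / 25 * mass m w)"
  shows "norm h \<le> \<gamma> / 26"
proof -
  have "norm h \<le> norm (h + c *\<^sub>R grad (Floc x n m) w) + norm (c *\<^sub>R grad (Floc x n m) w)"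
    using norm_triangle_ineq4[of "h + c *\<^sub>R grad (Floc x n m) w" "c *\<^sub>R grad (Floc x n m) w"] by simp
  moreover have "norm (c *\<^sub>R grad (Floc x n m) w) \<le> c * mass m w"
    using norm_grad_le[OF assms(1), of w] assms(2) by (simp add: mult_left_mono)
  moreover have "c * (\<gamma> / 25 * mass m w) \<le> c * mass m w / 25"
    using \<gamma>_le_1 mass_nonneg[of m w] assms(2) mult_right_mono[of \<gamma> 1 "c * mass m w"]
    by (simp add: mult_ac)
  ultimately show ?thesis using assms(3,4) \<gamma>_pos by linarith
qed

text \<open>Bootstrap: a small deviation up to step k keeps the iterate within \<gamma>/26 of w, so
  the next gradient is close to the one at w and the deviation grows by one more allowed
  increment.\<close>

lemma local_drift:
  assumes "m < M" "0 < \<eta>" "\<eta> * real K * mass m w \<le> \<gamma> / 28" "k \<le> K"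
  shows "norm (local_steps x n \<eta> m k w - w + (\<eta> * real k) *\<^sub>R grad (Floc x n m) w)
           \<le> \<eta> * real k * (\<gamma> / 25 * mass m w)"
  using assms(4)
proof (induction k)
  case 0
  then show ?case by (simp add: local_steps_0)
next
  case (Suc k)
  define h where "h = local_steps x n \<eta> m k w - w"
  define g where "g = grad (Floc x n m) w"
  define g' where "g' = grad (Floc x n m) (w + h)"
  have IH: "norm (h + (\<eta> * real k) *\<^sub>R g) \<le> \<eta> * real k * (\<gamma> / 25 * mass m w)"
    using Suc unfolding h_def g_def by simp
  have "\<eta> * real k * mass m w \<le> \<eta> * real K * mass m w"
    using Suc.prems assms(2) mass_nonneg[of m w] by (intro mult_right_mono mult_left_mono) auto
  then have "\<eta> * real k * mass m w \<le> \<gamma> / 28" using assms(3) by linarith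
  then have "norm h \<le> \<gamma> / 26"
    using IH assms(2) unfolding g_def by (intro norm_le_drift[OF assms(1)]) auto
  then have "norm (g' - g) \<le> \<gamma> / 25 * mass m w"
    unfolding g_def g'_def by (rule grad_perturb_small[OF assms(1)])
  then have "norm (\<eta> *\<^sub>R (g' - g)) \<le> \<eta> * (\<gamma> / 25 * mass m w)"
    using assms(2) by (simp add: mult_left_mono)
  moreover have "local_steps x n \<eta> m (Suc k) w - w + (\<eta> * real (Suc k)) *\<^sub>R g
      = (h + (\<eta> * real k) *\<^sub>R g) - \<eta> *\<^sub>R (g' - g)"
    unfolding local_steps_Suc h_def g'_def by (simp add: algebra_simps)
  ultimately show ?case
    using norm_triangle_ineq4[of "h + (\<eta> * real k) *\<^sub>R g" "\<eta> *\<^sub>R (g' - g)"] IH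
    unfolding g_def[symmetric] by (simp add: distrib_right distrib_left)
qed

text \<open>The gradient of F, taken directly as the average of the client gradients; it enters
  through the convexity inequality and norm bounds.\<close>

definition gradF :: "'a \<Rightarrow> 'a" where
  "gradF w = (1 / real M) *\<^sub>R (\<Sum>m<M. grad (Floc x n m) w)"

lemma Fglob_convex: "Fglob x M n w + gradF w \<bullet> (v - w) \<le> Fglob x M n v"
proof -
  have "Fglob x M n w + gradF w \<bullet> (v - w)
      = (1 / real M) * (\<Sum>m<M. Floc x n m w + grad (Floc x n m) w \<bullet> (v - w))"
    by (simp add: Fglob_def gradF_def inner_sum_left sum.distrib distrib_left)
  also have "\<dots> \<le> Fglob x M n v"
    unfolding Fglob_def by (intro mult_left_mono sum_mono Floc_convex) auto
  finally show ?thesis .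
qed

text \<open>Test the gradient against -\<open>ws\<close>: by the margin, client gradients cannot
  cancel in the average, however heterogeneous the data.\<close>

lemma total_mass_le_norm_gradF: "\<gamma> * total_mass w \<le> norm (gradF w)"
proof -
  have "\<gamma> * total_mass w = (1 / real M) * (\<Sum>m<M. \<gamma> * mass m w)"
    by (simp add: total_mass_eq sum_distrib_left)
  also have "\<dots> \<le> (1 / real M) * (\<Sum>m<M. - (grad (Floc x n m) w \<bullet> ws))"
    by (intro mult_left_mono sum_mono grad_margin) auto
  also have "\<dots> = - (gradF w \<bullet> ws)"
    by (simp add: gradF_def inner_sum_left sum_negf)
  also have "\<dots> \<le> norm (gradF w) * norm ws"
    using Cauchy_Schwarz_ineq2[of "gradF w" ws] by linarith
  finally show ?thesis by (simp add: norm_ws)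
qed

lemma norm_avg_le_mass:
  assumes "\<And>m. m < M \<Longrightarrow> norm (y m) \<le> c * (\<gamma> / 25 * mass m w)" "0 \<le> c"
  shows "norm ((1 / real M) *\<^sub>R (\<Sum>m<M. y m :: 'a)) \<le> c / 25 * norm (gradF w)"
proof -
  have "norm ((1 / real M) *\<^sub>R (\<Sum>m<M. y m)) \<le> (1 / real M) * (\<Sum>m<M. c * (\<gamma> / 25 * mass m w))"
    using assms by (intro norm_avg_le M_pos) auto
  also have "\<dots> = c / 25 * (\<gamma> * total_mass w)"
    by (simp add: total_mass_eq sum_distrib_left mult_ac flip: sum_divide_distrib)
  also have "\<dots> \<le> c / 25 * norm (gradF w)"
    using assms(2) by (intro mult_left_mono total_mass_le_norm_gradF) auto
  finally show ?thesis .
qed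

text \<open>The round moves by -c g + b with b of norm at most c/25 times that of g, and the
  gradient at the new point is g + a with a of norm at most 1/25 that of g.\<close>

lemma stable_descent:
  assumes \<eta>: "0 < \<eta>" and small: "\<And>m. m < M \<Longrightarrow> \<eta> * real K * mass m w \<le> \<gamma> / 28"
  shows "Fglob x M n (gd_round \<eta> K w) \<le> Fglob x M n w - 9 / 10 * (\<eta> * real K) * (norm (gradF w))\<^sup>2"
proof -
  define c where "c = \<eta> * real K"
  have c: "0 \<le> c" using \<eta> by (simp add: c_def)
  define h where "h m = local_steps x n \<eta> m K w - w" for m
  define H where "H = gd_round \<eta> K w - w"
  define g where "g = gradF w"
  define a where "a = gradF (w + H) - g"
  define b where "b = H + c *\<^sub>R g"
  have drift: "norm (h m + c *\<^sub>R grad (Floc x n m) w) \<le> c * (\<gamma> / 25 * mass m w)" if "m < M" for m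
    unfolding h_def c_def using local_drift[OF that \<eta> small[OF that]] by simp
  have H: "H = (1 / real M) *\<^sub>R (\<Sum>m<M. h m)"
    unfolding H_def h_def using M_pos
    by (simp add: sum_subtractf scaleR_right_diff_distrib sum_constant_scaleR)
  have "norm (h m) \<le> \<gamma> / 26" if "m < M" for m
    using norm_le_drift[OF that c _ drift[OF that]] small[OF that] by (simp add: c_def)
  then have "norm H \<le> (1 / real M) * (\<Sum>m<M. \<gamma> / 26)"
    unfolding H by (intro norm_avg_le M_pos)
  then have "norm H \<le> \<gamma> / 26" using M_pos by simp
  then have "norm ((1 / real M) *\<^sub>R (\<Sum>m<M. grad (Floc x n m) (w + H) - grad (Floc x n m) w))
      \<le> 1 / 25 * norm g"
    unfolding g_def by (intro norm_avg_le_mass) (simp_all only: mult_1 grad_perturb_small)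
  then have a: "norm a \<le> 1 / 25 * norm g"
    by (simp add: a_def g_def gradF_def sum_subtractf scaleR_right_diff_distrib)
  have "norm ((1 / real M) *\<^sub>R (\<Sum>m<M. h m + c *\<^sub>R grad (Floc x n m) w)) \<le> c / 25 * norm g"
    unfolding g_def using drift c by (intro norm_avg_le_mass) auto
  then have b: "norm b \<le> c / 25 * norm g"
    by (simp add: b_def H g_def gradF_def sum.distrib scaleR_right_distrib scaleR_sum_right mult_ac)
  \<comment> \<open>Convexity at the new point replaces a second-order Taylor bound, as \<open>gradF (w + H)\<close> is close to \<open>g\<close>.\<close>
  have "Fglob x M n (w + H) + gradF (w + H) \<bullet> (w - (w + H)) \<le> Fglob x M n w"
    by (rule Fglob_convex)
  then have "Fglob x M n (gd_round \<eta> K w) \<le> Fglob x M n w + gradF (w + H) \<bullet> H"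
    by (simp add: H_def inner_diff_right)
  also have "gradF (w + H) \<bullet> H = g \<bullet> b + a \<bullet> b - c * (a \<bullet> g) - c * (norm g)\<^sup>2"
    unfolding power2_norm_eq_inner
    by (simp add: a_def b_def inner_diff_left inner_diff_right inner_add_right inner_commute algebra_simps)
  also have "\<dots> \<le> c / 25 * (norm g)\<^sup>2 + c / 625 * (norm g)\<^sup>2 + c / 25 * (norm g)\<^sup>2 - c * (norm g)\<^sup>2"
  proof -
    have "g \<bullet> b \<le> norm g * norm b" by (rule norm_cauchy_schwarz)
    also have "\<dots> \<le> norm g * (c / 25 * norm g)" using b by (intro mult_left_mono) auto
    finally have 1: "g \<bullet> b \<le> c / 25 * (norm g)\<^sup>2" by (simp add: power2_eq_square mult_ac)
    have "a \<bullet> b \<le> norm a * norm b" by (rule norm_cauchy_schwarz)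
    also have "\<dots> \<le> (1 / 25 * norm g) * (c / 25 * norm g)" using a b by (intro mult_mono) auto
    finally have 2: "a \<bullet> b \<le> c / 625 * (norm g)\<^sup>2" by (simp add: power2_eq_square mult_ac)
    have "- (a \<bullet> g) \<le> norm a * norm g" using Cauchy_Schwarz_ineq2[of a g] by linarith
    also have "\<dots> \<le> (1 / 25 * norm g) * norm g" using a by (intro mult_right_mono) auto
    finally have "c * - (a \<bullet> g) \<le> c * ((1 / 25 * norm g) * norm g)" using c by (rule mult_left_mono)
    then have 3: "- (c * (a \<bullet> g)) \<le> c / 25 * (norm g)\<^sup>2" by (simp add: power2_eq_square mult_ac)
    show ?thesis using 1 2 3 by linarith
  qed
  \<comment> \<open>The errors add up to 2/25 + 1/625 < 1/10.\<close>
  also have "\<dots> \<le> - (9 / 10 * c * (norm g)\<^sup>2)"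
    using mult_nonneg_nonneg[OF c zero_le_power2[of "norm g"]] by simp
  finally show ?thesis by (simp add: c_def g_def)
qed

lemma Fglob_pos: "0 < Fglob x M n w"
  unfolding Fglob_def Floc_def using M_pos n_pos
  by (intro mult_pos_pos sum_pos logloss_pos) auto

text \<open>The bound 1/(2 M n) on \<psi> keeps every loss below 5/2, so weights are at least a
  third of the losses; the other bound gives drift 5 \<gamma>/140 = \<gamma>/28. The rate is 9/10 *
  (1/3)^2 = 1/10.\<close>

lemma stable_round:
  assumes "0 < \<eta>" "0 < K" "\<psi> \<le> 1 / (2 * real M * real n)"
    and "\<psi> \<le> \<gamma> / (140 * \<eta> * real K * real M)" and F: "Fglob x M n w \<le> 5 * \<psi>"
  shows "Fglob x M n (gd_round \<eta> K w) \<le> Fglob x M n w - \<eta> * \<gamma>\<^sup>2 * real K / 10 * (Fglob x M n w)\<^sup>2"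
proof -
  let ?F = "Fglob x M n w"
  have MK: "0 < real M" "0 < real n" "0 < real K" using M_pos n_pos assms by auto
  have "logloss (w \<bullet> x m i) \<le> 5 / 2" if "m < M" "i < n" for m i
  proof -
    have "logloss (w \<bullet> x m i) \<le> real M * real n * ?F"
      unfolding Fglob_eq_mean2 by (rule mean2_member[OF _ that]) (simp add: logloss_pos less_imp_le)
    also have "\<dots> \<le> real M * real n * (5 * (1 / (2 * real M * real n)))"
      using F assms(3) by (intro mult_left_mono) auto
    also have "\<dots> = 5 / 2" using MK by (simp add: field_simps)
    finally show ?thesis .
  qed
  then have "mean2 M n (\<lambda>m i. 1 / 3 * logloss (w \<bullet> x m i) + 0) \<le> total_mass w"
    by (intro mean2_mono) (use slope_ge_logloss_2 in auto)
  then have mass: "?F / 3 \<le> total_mass w"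
    unfolding mean2_affine[OF M_pos n_pos] Fglob_eq_mean2 by simp
  have "\<eta> * real K * mass m w \<le> \<gamma> / 28" if "m < M" for m
  proof -
    have "mass m w \<le> Floc x n m w" by (rule mass_le_Floc)
    also have "\<dots> \<le> (\<Sum>m<M. Floc x n m w)"
      using that order_trans[OF mass_nonneg mass_le_Floc] by (intro member_le_sum) auto
    also have "\<dots> = real M * ?F" using MK by (simp add: Fglob_def)
    also have "\<dots> \<le> real M * (5 * (\<gamma> / (140 * \<eta> * real K * real M)))"
      using F assms(4) by (intro mult_left_mono) auto
    finally have "\<eta> * real K * mass m w \<le> \<eta> * real K * (real M * (5 * (\<gamma> / (140 * \<eta> * real K * real M))))"
      using assms(1) by (intro mult_left_mono) auto
    also have "\<dots> = \<gamma> / 28" using MK assms(1) by (simp add: field_simps)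
    finally show ?thesis .
  qed
  then have desc: "Fglob x M n (gd_round \<eta> K w) \<le> ?F - 9 / 10 * (\<eta> * real K) * (norm (gradF w))\<^sup>2"
    by (rule stable_descent[OF assms(1)])
  have "\<gamma> * (?F / 3) \<le> \<gamma> * total_mass w"
    using mass \<gamma>_pos by (intro mult_left_mono) auto
  also have "\<dots> \<le> norm (gradF w)" by (rule total_mass_le_norm_gradF)
  finally have "(\<gamma> * (?F / 3))\<^sup>2 \<le> (norm (gradF w))\<^sup>2"
    using \<gamma>_pos Fglob_pos[of w] by (intro power_mono) auto
  then have "9 / 10 * (\<eta> * real K) * (\<gamma> * (?F / 3))\<^sup>2 \<le> 9 / 10 * (\<eta> * real K) * (norm (gradF w))\<^sup>2"
    using assms(1) by (intro mult_left_mono) auto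
  then show ?thesis using desc by (simp add: power2_eq_square mult_ac)
qed

text \<open>The bound 5 \<psi> is carried along because each step of the induction needs the iterate
  to be still in the stable region.\<close>

lemma stable_rate:
  assumes "0 < \<eta>" "0 < K" "\<psi> \<le> 1 / (2 * real M * real n)"
    and "\<psi> \<le> \<gamma> / (140 * \<eta> * real K * real M)"
    and start: "Fglob x M n (localGD x M n \<eta> K w0 s) \<le> 5 * \<psi>"
  shows "Fglob x M n (localGD x M n \<eta> K w0 (s + j)) \<le> 5 * \<psi> \<and>
         real j * (\<eta> * \<gamma>\<^sup>2 * real K / 10) \<le> 1 / Fglob x M n (localGD x M n \<eta> K w0 (s + j))"
proof (induction j)
  case 0
  then show ?case using start Fglob_pos by (simp add: less_imp_le)
next
  case (Suc j)
  let ?F = "\<lambda>j. Fglob x M n (localGD x M n \<eta> K w0 (s + j))"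
  let ?c = "\<eta> * \<gamma>\<^sup>2 * real K / 10"
  have c: "0 \<le> ?c" using assms by simp
  have step: "?F (Suc j) \<le> ?F j - ?c * (?F j)\<^sup>2"
    using stable_round[OF assms(1-4) conjunct1[OF Suc]] by simp
  then have "?F (Suc j) \<le> 5 * \<psi>"
    using Suc mult_nonneg_nonneg[OF c zero_le_power2[of "?F j"]] by linarith
  moreover have "1 / ?F j + ?c \<le> 1 / ?F (Suc j)"
    by (rule inverse_descent[OF Fglob_pos step c Fglob_pos])
  ultimately show ?case using Suc by (simp add: distrib_right)
qed

end

subsection \<open>The maximum margin\<close>

text \<open>A minimum of finitely many linear functions is continuous, so the supremum over the
  compact unit sphere is attained; a separating direction makes it positive.\<close>

lemma max_margin_attained:
  fixes x :: "nat \<Rightarrow> nat \<Rightarrow> 'a::euclidean_space"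
  assumes "M > 0" "n > 0"
  shows "\<exists>ws. norm ws = 1 \<and> (\<forall>m<M. \<forall>i<n. max_margin x M n \<le> ws \<bullet> x m i)"
    and "norm w = 1 \<Longrightarrow> (\<And>m i. m < M \<Longrightarrow> i < n \<Longrightarrow> 0 < w \<bullet> x m i) \<Longrightarrow> 0 < max_margin x M n"
proof -
  define I where "I = {..<M} \<times> {..<n}"
  have I: "finite I" "I \<noteq> {}" using assms by (auto simp: I_def)
  define f where "f w = Min ((\<lambda>(m, i). w \<bullet> x m i) ` I)" for w
  have f: "Min {w \<bullet> x m i | m i. m < M \<and> i < n} = f w" for w
    unfolding f_def I_def by (rule arg_cong[of _ _ Min]) auto
  have cont: "continuous_on S (\<lambda>w. Min ((\<lambda>(m, i). w \<bullet> x m i) ` J))" if "finite J" "J \<noteq> {}" for S J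
    using that
  proof (induction J rule: finite_ne_induct)
    case (singleton p)
    then show ?case by (cases p) (auto intro!: continuous_intros)
  next
    case (insert p J)
    then show ?case
      by (cases p) (auto simp: Min_insert intro!: continuous_intros)
  qed
  have "{w :: 'a. norm w = 1} = sphere 0 1" by auto
  then have mm: "max_margin x M n = (SUP w\<in>sphere 0 1. f w)"
    unfolding max_margin_def f by simp
  have "sphere (0::'a) 1 \<noteq> {}" by simp
  then obtain ws where ws: "ws \<in> sphere 0 1" "\<And>w. w \<in> sphere 0 1 \<Longrightarrow> f w \<le> f ws"
    using continuous_attains_sup[OF compact_sphere, of 0 1 f] cont[OF I] unfolding f_def by blast
  have max: "max_margin x M n = f ws"
    unfolding mm using ws by (intro cSup_eq_maximum) auto
  have "f ws \<le> ws \<bullet> x m i" if "m < M" "i < n" for m i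
    unfolding f_def using I that by (intro Min_le) (force simp: I_def)+
  then show "\<exists>ws. norm ws = 1 \<and> (\<forall>m<M. \<forall>i<n. max_margin x M n \<le> ws \<bullet> x m i)"
    using ws max by auto
  assume "norm w = 1" and pos: "\<And>m i. m < M \<Longrightarrow> i < n \<Longrightarrow> 0 < w \<bullet> x m i"
  have "0 < f w"
    unfolding f_def using I pos by (subst Min_gr_iff) (auto simp: I_def)
  also have "\<dots> \<le> f ws" using ws \<open>norm w = 1\<close> by simp
  finally show "0 < max_margin x M n" by (simp add: max)
qed

lemma separable_data_max_margin:
  fixes x :: "nat \<Rightarrow> nat \<Rightarrow> 'a::euclidean_space"
  assumes "M > 0" "n > 0" "\<And>m i. m < M \<Longrightarrow> i < n \<Longrightarrow> norm (x m i) \<le> 1"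
    and "\<exists>w. \<forall>m<M. \<forall>i<n. w \<bullet> x m i > 0"
  obtains ws where "separable_data x M n (max_margin x M n) ws"
proof -
  obtain w where w: "\<And>m i. m < M \<Longrightarrow> i < n \<Longrightarrow> 0 < w \<bullet> x m i" using assms(4) by blast
  then have "w \<noteq> 0" using assms(1,2) by fastforce
  then have "0 < max_margin x M n"
    using w by (intro max_margin_attained(2)[OF assms(1,2), of "w /\<^sub>R norm w"]) auto
  moreover obtain ws where "norm ws = 1" "\<forall>m<M. \<forall>i<n. max_margin x M n \<le> ws \<bullet> x m i"
    using max_margin_attained(1)[OF assms(1,2)] by blast
  ultimately have "separable_data x M n (max_margin x M n) ws"
    using assms by unfold_locales auto
  then show thesis by (rule that)
qed

section \<open>Combining the two phases\<close>

theorem theorem4p2: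
  fixes x :: "nat \<Rightarrow> nat \<Rightarrow> 'a::euclidean_space"
    and M n K r :: nat and \<eta> \<gamma> \<psi> \<tau> :: real and w0 :: 'a
  assumes "M > 0" and "n > 0" and "K > 0"
    and "\<And>m i. m < M \<Longrightarrow> i < n \<Longrightarrow> norm (x m i) \<le> 1"
    and "\<exists>w. \<forall>m<M. \<forall>i<n. w \<bullet> x m i > 0"
    and "\<gamma> = max_margin x M n"
    and "\<eta> > 0"
    and "\<psi> = min (\<gamma> / (140 * \<eta> * real K * real M)) (1 / (2 * real M * real n))"
    and "\<tau> = (4 * \<gamma> * norm w0 + 2 * sqrt 2 + 2 * \<eta>
               + ln (1 + sqrt (real K) / (sqrt \<eta> * \<gamma> * \<psi>))) / (\<eta> * \<gamma>^2 * \<psi>)"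
    and "real r > \<tau>"
  shows "Fglob x M n (localGD x M n \<eta> K w0 r) \<le> 16 / (\<eta> * \<gamma>^2 * real K * (real r - \<tau>))"
proof -
  obtain ws where "separable_data x M n \<gamma> ws"
    using separable_data_max_margin[OF assms(1,2,4,5)] assms(6) by blast
  then interpret separable_data x M n \<gamma> ws .
  note \<eta> = \<open>\<eta> > 0\<close> and \<tau> = assms(9)
  have \<psi>1: "\<psi> \<le> 1 / (2 * real M * real n)" and \<psi>2: "\<psi> \<le> \<gamma> / (140 * \<eta> * real K * real M)"
    using assms(8) by auto
  have \<psi>: "0 < \<psi>" using assms \<gamma>_pos by simp
  have K: "1 \<le> real K" using \<open>K > 0\<close> by simp
  \<comment> \<open>\<open>L\<close> is log(sqrt K / \<psi>), so exp(-2 L) = \<psi>^2 / K. The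
    choice of \<open>a\<close> gives \<gamma> (norm w0 + R) = 2 L + 3 a.\<close>
  define L where "L = ln (real K) / 2 - ln \<psi>"
  define a where "a = \<gamma> * norm w0 + \<eta> / 2"
  define \<Lambda> where "\<Lambda> = L + a"
  define R where "R = (2 * \<Lambda> + \<eta> / 2) / \<gamma>"
  define T where "T = 4 * \<gamma> * norm w0 + 2 * sqrt 2 + 2 * \<eta>
               + ln (1 + sqrt (real K) / (sqrt \<eta> * \<gamma> * \<psi>))"
  have a: "0 \<le> a" using \<gamma>_pos \<eta> by (simp add: a_def)
  have "1 \<le> real M * real n" using M_pos n_pos by (simp flip: of_nat_mult)
  then have "1 / (2 * real M * real n) \<le> 1 / 2" by (simp add: field_simps)
  then have "\<psi> < 1" using \<psi>1 by linarith
  then have "ln \<psi> < 0" using \<psi> by simp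
  moreover have "0 \<le> ln (real K)" using K by simp
  ultimately have L: "0 < L" unfolding L_def by simp
  have \<Lambda>: "0 < \<Lambda>" using L a by (simp add: \<Lambda>_def)
  have R: "0 \<le> R" "R * \<gamma> = 2 * \<Lambda> + \<eta> / 2" using \<Lambda> \<eta> \<gamma>_pos by (auto simp: R_def)
  have "exp (- (2 * \<Lambda>)) \<le> exp (- (2 * L))" using a by (simp add: \<Lambda>_def)
  also have "\<dots> = exp (ln \<psi> + ln \<psi> - ln (real K))" by (simp add: L_def)
  also have "\<dots> = \<psi>\<^sup>2 / real K"
    using \<psi> K by (simp only: exp_add exp_diff) (simp add: power2_eq_square)
  finally have K\<Lambda>: "real K * exp (- (2 * \<Lambda>)) \<le> \<psi>\<^sup>2"
    using K by (simp add: field_simps)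
  have T: "L + 3 * a \<le> T"
  proof -
    have pos: "0 < sqrt (real K) / (sqrt \<eta> * \<gamma> * \<psi>)" using K \<eta> \<gamma>_pos \<psi> by simp
    \<comment> \<open>Since ln \<eta> <= \<eta> - 1 and ln \<gamma> <= 0, the factors sqrt \<eta>
      and \<gamma> inside the logarithm cost at most \<eta>/2, which the term 2 \<eta> of
      \<open>T\<close> pays beside the 3/2 \<eta> in 3 a.\<close>
    have "L - \<eta> / 2 \<le> L - ln \<eta> / 2 - ln \<gamma>"
      using ln_le_minus_one[OF \<eta>] \<gamma>_pos \<gamma>_le_1 ln_le_zero_iff[of \<gamma>] by linarith
    also have "\<dots> = ln (sqrt (real K) / (sqrt \<eta> * \<gamma> * \<psi>))"
      using K \<eta> \<gamma>_pos \<psi> by (simp add: L_def ln_div ln_mult ln_sqrt)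
    also have "\<dots> \<le> ln (1 + sqrt (real K) / (sqrt \<eta> * \<gamma> * \<psi>))" using pos by simp
    finally have "L - \<eta> / 2 \<le> ln (1 + sqrt (real K) / (sqrt \<eta> * \<gamma> * \<psi>))" .
    moreover have "3 * (\<gamma> * norm w0) \<le> 4 * \<gamma> * norm w0" using \<gamma>_pos by simp
    moreover have "3 * a = 3 * (\<gamma> * norm w0) + 2 * \<eta> - \<eta> / 2" by (simp add: a_def)
    moreover have "0 \<le> sqrt 2" by simp
    ultimately show ?thesis unfolding T_def by linarith
  qed
  have rate: "0 < \<eta> * \<gamma>\<^sup>2 * \<psi>" using \<eta> \<gamma>_pos \<psi> by simp
  have \<tau>T: "\<tau> * (\<eta> * \<gamma>\<^sup>2 * \<psi>) = T" unfolding \<tau> T_def[symmetric] using rate by (simp only: nonzero_eq_divide_eq[symmetric])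
  have \<tau>0: "0 \<le> \<tau>"
  proof (rule mult_right_le_imp_le[OF _ rate])
    show "0 * (\<eta> * \<gamma>\<^sup>2 * \<psi>) \<le> \<tau> * (\<eta> * \<gamma>\<^sup>2 * \<psi>)"
      unfolding \<tau>T using T L a by simp
  qed
  obtain s where s: "real s \<le> \<tau>" and start: "Fglob x M n (localGD x M n \<eta> K w0 s) \<le> 5 * \<psi>"
  proof (rule ccontr)
    assume neg: "\<not> thesis"
    note found = that
    \<comment> \<open>The least natural number above \<tau>: if no round up to \<tau> were stable,
      all of the first \<open>S\<close> rounds would be unstable, and \<open>unstable_time\<close>
      forces S <= \<tau>.\<close>
    define S where "S = Suc (nat \<lfloor>\<tau>\<rfloor>)"
    have "5 * \<psi> < Fglob x M n (localGD x M n \<eta> K w0 s)" if "s < S" for s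
    proof -
      have "real s \<le> \<tau>" using that \<tau>0 unfolding S_def by (simp add: less_Suc_eq_le le_nat_iff le_floor_iff)
      then show ?thesis using neg found not_le by blast
    qed
    then have S: "real S * (4 * \<eta> * \<Lambda> * \<psi>) \<le> (norm (w0 - R *\<^sub>R ws))\<^sup>2"
      by (rule unstable_time[OF \<eta> \<open>K > 0\<close> \<psi> \<psi>1 K\<Lambda> R])
    have "norm (w0 - R *\<^sub>R ws) \<le> norm w0 + R"
      using norm_triangle_ineq4[of w0 "R *\<^sub>R ws"] R norm_ws by simp
    then have "\<gamma> * norm (w0 - R *\<^sub>R ws) \<le> \<gamma> * (norm w0 + R)"
      using \<gamma>_pos by (intro mult_left_mono) auto
    also have "\<dots> = 2 * L + 3 * a"
      using R(2) by (simp add: algebra_simps \<Lambda>_def a_def)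
    finally have "(\<gamma> * norm (w0 - R *\<^sub>R ws))\<^sup>2 \<le> (2 * L + 3 * a)\<^sup>2"
      using \<gamma>_pos by (intro power_mono) auto
    \<comment> \<open>Chosen so that the factor 4 \<Lambda> = 4 (L + a) cancels against the decrease
      per round.\<close>
    also have "\<dots> \<le> 4 * \<Lambda> * (L + 3 * a)"
      using L a mult_nonneg_nonneg[of L a] by (simp add: \<Lambda>_def algebra_simps power2_eq_square)
    finally have *: "\<gamma>\<^sup>2 * (norm (w0 - R *\<^sub>R ws))\<^sup>2 \<le> 4 * \<Lambda> * (L + 3 * a)"
      by (simp add: power_mult_distrib)
    have "4 * \<Lambda> * (real S * (\<eta> * \<gamma>\<^sup>2 * \<psi>)) = \<gamma>\<^sup>2 * (real S * (4 * \<eta> * \<Lambda> * \<psi>))" by simp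
    also have "\<dots> \<le> \<gamma>\<^sup>2 * (norm (w0 - R *\<^sub>R ws))\<^sup>2" using S by (intro mult_left_mono) auto
    also have "\<dots> \<le> 4 * \<Lambda> * T"
      using * T \<Lambda> mult_left_mono[OF T, of "4 * \<Lambda>"] by linarith
    finally have "real S * (\<eta> * \<gamma>\<^sup>2 * \<psi>) \<le> \<tau> * (\<eta> * \<gamma>\<^sup>2 * \<psi>)"
      unfolding \<tau>T using \<Lambda> by (subst (asm) mult_le_cancel_left_pos) auto
    then have "real S \<le> \<tau>" using rate by (subst (asm) mult_le_cancel_right_pos) auto
    then show False unfolding S_def by linarith
  qed
  define F where "F = Fglob x M n (localGD x M n \<eta> K w0 r)"
  have F: "0 < F" unfolding F_def by (rule Fglob_pos)
  have sr: "s \<le> r" using s \<open>real r > \<tau>\<close> by linarith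
  let ?c = "\<eta> * \<gamma>\<^sup>2 * real K"
  have c: "0 < ?c" using \<eta> \<gamma>_pos K by simp
  \<comment> \<open>The rate counts rounds from \<open>s\<close>, and s <= \<tau>; the constant 10
    is relaxed to 16.\<close>
  have "(real r - \<tau>) * (?c / 16) \<le> (real r - real s) * (?c / 10)"
    using s \<eta> \<open>real r > \<tau>\<close> by (intro mult_mono) auto
  also have "\<dots> \<le> 1 / F"
    using conjunct2[OF stable_rate[OF \<eta> \<open>K > 0\<close> \<psi>1 \<psi>2 start, of "r - s"]] sr
    by (simp add: F_def of_nat_diff)
  finally have "F * ((real r - \<tau>) * ?c) \<le> 16" using F by (simp add: field_simps)
  moreover have "0 < ?c * (real r - \<tau>)" using \<open>real r > \<tau>\<close> by (intro mult_pos_pos c) simp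
  ultimately show ?thesis
    unfolding F_def[symmetric] by (simp only: pos_le_divide_eq mult.commute[of ?c])
qed

end
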